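(* Let $(M, g, \nabla)$ be a statistical manifold of constant curvature, and for $\alpha\in\mathbb{R}$ let $\nabla^{\alpha} = \widehat\nabla + \alpha K$ be the $\alpha$-connection. Assume that the pseudo-Riemannian metric $g$ is not of constant curvature. Then the statistical manifold $(M,g,\nabla^\alpha)$ does not have constant curvature except for $\alpha=\pm 1$, that is, the cases $\nabla^{1}=\nabla$ and $\nabla^{-1}=\nabla^*$.
   Context: All objects are smooth and $M$ is orientable. A statistical manifold $(M,g,\nabla)$ is a pseudo-Riemannian manifold $(M,g)$ with a torsion-free affine connection $\nabla$ such that $C(X,Y,Z) = (\nabla_X g)(Y,Z)$ is totally symmetric. The dual connection $\nabla^*$ is the torsion-free affine connection defined by $X g(Y,Z) = g(\nabla_X Y, Z) + g(Y, \nabla^*_X Z)$. $\widehat\nabla$ is the Levi-Civita connection of $g$, and $K(X,Y) = \nabla_X Y - \widehat\nabla_X Y$ is the difference tensor; $(g,\nabla^\alpha)$ is again a statistical structure for every $\alpha\in\mathbb{R}$. A statistical manifold $(M,g,\nabla)$ has constant curvature if there is a real constant $k$ such that the curvature tensor $R(X,Y)Z = \nabla_X\nabla_Y Z - \nabla_Y\nabla_X Z - \nabla_{[X,Y]}Z$ satisfies $R(X,Y)Z = k\{g(Y,Z)X - g(X,Z)Y\}$ for all vector fields $X,Y,Z$; the metric $g$ has constant curvature if the same holds for the curvature tensor of $\widehat\nabla$. *)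

theory Defs
  imports "HOL-Analysis.Analysis"
begin

section \<open>Smooth manifolds\<close>

text \<open>\<open>Ck_on k S f\<close>: \<open>f\<close> is \<open>k\<close> times continuously differentiable on the open set \<open>S\<close>.\<close>

primrec Ck_on :: "nat \<Rightarrow> 'a::real_normed_vector set \<Rightarrow> ('a \<Rightarrow> 'b::real_normed_vector) \<Rightarrow> bool" where
  "Ck_on 0 S f \<longleftrightarrow> continuous_on S f"
| "Ck_on (Suc k) S f \<longleftrightarrow>
     (\<forall>x\<in>S. f differentiable (at x)) \<and> (\<forall>v. Ck_on k S (\<lambda>x. frechet_derivative f (at x) v))"

definition smooth_on :: "'a::real_normed_vector set \<Rightarrow> ('a \<Rightarrow> 'b::real_normed_vector) \<Rightarrow> bool" where
  "smooth_on S f \<longleftrightarrow> (\<forall>k. Ck_on k S f)"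

text \<open>The underlying topological space of the manifold is the whole type \<open>'m\<close>; it is required to
  be Hausdorff and second countable through its type classes. A chart is a pair of its domain and
  a map that is only meaningful on this domain.\<close>

type_synonym ('m, 'n) chart = "'m set \<times> ('m \<Rightarrow> real ^ 'n)"

definition transition :: "('m, 'n::finite) chart \<Rightarrow> ('m, 'n) chart \<Rightarrow> real ^ 'n \<Rightarrow> real ^ 'n" where
  "transition c d = snd d \<circ> inv_into (fst c) (snd c)"

definition smooth_atlas ::
    "('m::{t2_space, second_countable_topology}, 'n::finite) chart set \<Rightarrow> bool" where
  "smooth_atlas A \<longleftrightarrow>
     (\<forall>(U, \<phi>)\<in>A. open U \<and> open (\<phi> ` U) \<and> homeomorphism U (\<phi> ` U) \<phi> (inv_into U \<phi>)) \<and>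
     (\<Union>(U, \<phi>)\<in>A. U) = UNIV \<and>
     (\<forall>c\<in>A. \<forall>d\<in>A. smooth_on (snd c ` (fst c \<inter> fst d)) (transition c d))"

definition oriented_atlas ::
    "('m::{t2_space, second_countable_topology}, 'n::finite) chart set \<Rightarrow> bool" where
  "oriented_atlas A \<longleftrightarrow> smooth_atlas A \<and>
     (\<forall>c\<in>A. \<forall>d\<in>A. \<forall>x \<in> snd c ` (fst c \<inter> fst d).
        det (matrix (frechet_derivative (transition c d) (at x))) > 0)"

text \<open>Two atlases define the same smooth structure iff their union is an atlas.\<close>

definition orientable ::
    "('m::{t2_space, second_countable_topology}, 'n::finite) chart set \<Rightarrow> bool" where
  "orientable A \<longleftrightarrow> (\<exists>B. oriented_atlas B \<and> smooth_atlas (A \<union> B))"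

definition smooth_functions :: "('m, 'n::finite) chart set \<Rightarrow> ('m \<Rightarrow> real) set" where
  "smooth_functions A = {f. \<forall>(U, \<phi>)\<in>A. smooth_on (\<phi> ` U) (f \<circ> inv_into U \<phi>)}"


section \<open>Vector fields\<close>

text \<open>Smooth vector fields are the derivations of the algebra of smooth functions; \<open>X f p\<close> is the
  derivative of \<open>f\<close> at \<open>p\<close> in the direction of the tangent vector \<open>X\<^sub>p\<close>. The last clause fixes the
  irrelevant values outside the algebra, so that vector fields are equal iff they are equal in HOL.\<close>

type_synonym 'm vfield = "('m \<Rightarrow> real) \<Rightarrow> 'm \<Rightarrow> real"

definition vector_fields :: "('m, 'n::finite) chart set \<Rightarrow> 'm vfield set" where
  "vector_fields A = {X.
     (\<forall>f\<in>smooth_functions A. X f \<in> smooth_functions A) \<and>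
     (\<forall>f\<in>smooth_functions A. \<forall>h\<in>smooth_functions A.
        X (\<lambda>p. f p + h p) = (\<lambda>p. X f p + X h p)) \<and>
     (\<forall>c. \<forall>f\<in>smooth_functions A. X (\<lambda>p. c * f p) = (\<lambda>p. c * X f p)) \<and>
     (\<forall>f\<in>smooth_functions A. \<forall>h\<in>smooth_functions A.
        X (\<lambda>p. f p * h p) = (\<lambda>p. f p * X h p + h p * X f p)) \<and>
     (\<forall>f. f \<notin> smooth_functions A \<longrightarrow> X f = (\<lambda>p. 0))}"

definition vf_add :: "'m vfield \<Rightarrow> 'm vfield \<Rightarrow> 'm vfield" where
  "vf_add X Y = (\<lambda>f p. X f p + Y f p)"

definition vf_diff :: "'m vfield \<Rightarrow> 'm vfield \<Rightarrow> 'm vfield" where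
  "vf_diff X Y = (\<lambda>f p. X f p - Y f p)"

definition vf_scale :: "('m \<Rightarrow> real) \<Rightarrow> 'm vfield \<Rightarrow> 'm vfield" where
  "vf_scale h X = (\<lambda>f p. h p * X f p)"

definition lie_bracket :: "'m vfield \<Rightarrow> 'm vfield \<Rightarrow> 'm vfield" where
  "lie_bracket X Y = (\<lambda>f p. X (Y f) p - Y (X f) p)"


section \<open>Metrics and connections\<close>

text \<open>As usual, a covariant tensor field is a \<open>C\<^sup>\<infinity>\<close>-multilinear map on vector fields. The last
  clause is nondegeneracy at every point \<open>p\<close>: if \<open>g\<^sub>p(X\<^sub>p, Y\<^sub>p) = 0\<close> for all \<open>Y\<^sub>p\<close>, then \<open>X\<^sub>p = 0\<close>.\<close>

type_synonym 'm metric = "'m vfield \<Rightarrow> 'm vfield \<Rightarrow> 'm \<Rightarrow> real"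

definition pseudo_riemannian_metric :: "('m, 'n::finite) chart set \<Rightarrow> 'm metric \<Rightarrow> bool" where
  "pseudo_riemannian_metric A g \<longleftrightarrow>
     (\<forall>X\<in>vector_fields A. \<forall>Y\<in>vector_fields A. g X Y \<in> smooth_functions A) \<and>
     (\<forall>X\<in>vector_fields A. \<forall>Y\<in>vector_fields A. g X Y = g Y X) \<and>
     (\<forall>X\<in>vector_fields A. \<forall>Y\<in>vector_fields A. \<forall>Z\<in>vector_fields A.
        g (vf_add X Y) Z = (\<lambda>p. g X Z p + g Y Z p)) \<and>
     (\<forall>h\<in>smooth_functions A. \<forall>X\<in>vector_fields A. \<forall>Y\<in>vector_fields A.
        g (vf_scale h X) Y = (\<lambda>p. h p * g X Y p)) \<and>
     (\<forall>p. \<forall>X\<in>vector_fields A.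
        (\<forall>Y\<in>vector_fields A. g X Y p = 0) \<longrightarrow> (\<forall>f\<in>smooth_functions A. X f p = 0))"

text \<open>\<open>D X Y\<close> is the covariant derivative of \<open>Y\<close> along \<open>X\<close>. Only its values on vector fields matter.\<close>

type_synonym 'm connection = "'m vfield \<Rightarrow> 'm vfield \<Rightarrow> 'm vfield"

definition affine_connection :: "('m, 'n::finite) chart set \<Rightarrow> 'm connection \<Rightarrow> bool" where
  "affine_connection A D \<longleftrightarrow>
     (\<forall>X\<in>vector_fields A. \<forall>Y\<in>vector_fields A. D X Y \<in> vector_fields A) \<and>
     (\<forall>X\<in>vector_fields A. \<forall>Y\<in>vector_fields A. \<forall>Z\<in>vector_fields A.
        D (vf_add X Y) Z = vf_add (D X Z) (D Y Z)) \<and>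
     (\<forall>h\<in>smooth_functions A. \<forall>X\<in>vector_fields A. \<forall>Y\<in>vector_fields A.
        D (vf_scale h X) Y = vf_scale h (D X Y)) \<and>
     (\<forall>X\<in>vector_fields A. \<forall>Y\<in>vector_fields A. \<forall>Z\<in>vector_fields A.
        D X (vf_add Y Z) = vf_add (D X Y) (D X Z)) \<and>
     (\<forall>h\<in>smooth_functions A. \<forall>X\<in>vector_fields A. \<forall>Y\<in>vector_fields A.
        D X (vf_scale h Y) = vf_add (vf_scale (X h) Y) (vf_scale h (D X Y)))"

definition connection_eq ::
    "('m, 'n::finite) chart set \<Rightarrow> 'm connection \<Rightarrow> 'm connection \<Rightarrow> bool" where
  "connection_eq A D E \<longleftrightarrow> (\<forall>X\<in>vector_fields A. \<forall>Y\<in>vector_fields A. D X Y = E X Y)"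

definition torsion_free :: "('m, 'n::finite) chart set \<Rightarrow> 'm connection \<Rightarrow> bool" where
  "torsion_free A D \<longleftrightarrow> (\<forall>X\<in>vector_fields A. \<forall>Y\<in>vector_fields A.
     vf_diff (D X Y) (D Y X) = lie_bracket X Y)"

text \<open>\<open>cubic_form g D X Y Z = (\<nabla>\<^sub>X g)(Y, Z)\<close>.\<close>

definition cubic_form ::
    "'m metric \<Rightarrow> 'm connection \<Rightarrow> 'm vfield \<Rightarrow> 'm vfield \<Rightarrow> 'm vfield \<Rightarrow> 'm \<Rightarrow> real" where
  "cubic_form g D X Y Z = (\<lambda>p. X (g Y Z) p - g (D X Y) Z p - g Y (D X Z) p)"

text \<open>The two transpositions below generate all permutations of the three arguments.\<close>

definition statistical_structure ::
    "('m, 'n::finite) chart set \<Rightarrow> 'm metric \<Rightarrow> 'm connection \<Rightarrow> bool" where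
  "statistical_structure A g D \<longleftrightarrow>
     pseudo_riemannian_metric A g \<and> affine_connection A D \<and> torsion_free A D \<and>
     (\<forall>X\<in>vector_fields A. \<forall>Y\<in>vector_fields A. \<forall>Z\<in>vector_fields A.
        cubic_form g D X Y Z = cubic_form g D Y X Z \<and>
        cubic_form g D X Y Z = cubic_form g D X Z Y)"

definition levi_civita ::
    "('m, 'n::finite) chart set \<Rightarrow> 'm metric \<Rightarrow> 'm connection \<Rightarrow> bool" where
  "levi_civita A g D \<longleftrightarrow> affine_connection A D \<and> torsion_free A D \<and>
     (\<forall>X\<in>vector_fields A. \<forall>Y\<in>vector_fields A. \<forall>Z\<in>vector_fields A.
        cubic_form g D X Y Z = (\<lambda>p. 0))"

definition dual_connection ::
    "('m, 'n::finite) chart set \<Rightarrow> 'm metric \<Rightarrow> 'm connection \<Rightarrow> 'm connection \<Rightarrow> bool" where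
  "dual_connection A g D E \<longleftrightarrow> affine_connection A E \<and> torsion_free A E \<and>
     (\<forall>X\<in>vector_fields A. \<forall>Y\<in>vector_fields A. \<forall>Z\<in>vector_fields A.
        X (g Y Z) = (\<lambda>p. g (D X Y) Z p + g Y (E X Z) p))"

text \<open>In the next two definitions \<open>L\<close> stands for the Levi-Civita connection.\<close>

definition difference_tensor :: "'m connection \<Rightarrow> 'm connection \<Rightarrow> 'm connection" where
  "difference_tensor L D X Y = vf_diff (D X Y) (L X Y)"

definition alpha_connection ::
    "'m connection \<Rightarrow> 'm connection \<Rightarrow> real \<Rightarrow> 'm connection" where
  "alpha_connection L D \<alpha> X Y = vf_add (L X Y) (vf_scale (\<lambda>p. \<alpha>) (difference_tensor L D X Y))"

definition curvature ::
    "'m connection \<Rightarrow> 'm vfield \<Rightarrow> 'm vfield \<Rightarrow> 'm vfield \<Rightarrow> 'm vfield" where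
  "curvature D X Y Z =
     vf_diff (vf_diff (D X (D Y Z)) (D Y (D X Z))) (D (lie_bracket X Y) Z)"

definition constant_curvature ::
    "('m, 'n::finite) chart set \<Rightarrow> 'm metric \<Rightarrow> 'm connection \<Rightarrow> bool" where
  "constant_curvature A g D \<longleftrightarrow>
     (\<exists>k::real. \<forall>X\<in>vector_fields A. \<forall>Y\<in>vector_fields A. \<forall>Z\<in>vector_fields A.
        curvature D X Y Z =
          vf_scale (\<lambda>p. k) (vf_diff (vf_scale (g Y Z) X) (vf_scale (g X Z) Y)))"

end

theory Submission
  imports Defs
begin

text \<open>
  The connection \<open>\<nabla>\<^sup>\<alpha> = (1 - \<alpha>) \<nabla>\<^sup>0 + \<alpha> \<nabla>\<close> is affine in \<open>\<alpha>\<close>, so its curvature is a quadratic polynomial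
  in \<open>\<alpha>\<close>; interpolating at \<open>0, 1, -1\<close> gives
  \<open>R\<^sup>\<alpha> = (1 - \<alpha>\<^sup>2) R\<^sup>0 + (\<alpha>\<^sup>2 + \<alpha>)/2 R\<^sup>1 + (\<alpha>\<^sup>2 - \<alpha>)/2 R\<^sup>-\<^sup>1\<close>.
  The total symmetry of the cubic form makes \<open>\<nabla>\<^sup>-\<^sup>1\<close> dual to \<open>\<nabla>\<close>, and duality gives
  \<open>g(R(X,Y)Z, W) = - g(Z, R\<^sup>*(X,Y)W)\<close>, so \<open>R\<^sup>1\<close> and \<open>R\<^sup>-\<^sup>1\<close> have the same constant curvature \<open>k\<close>.
  Hence \<open>R\<^sup>\<alpha> = (1 - \<alpha>\<^sup>2) R\<^sup>0 + \<alpha>\<^sup>2 k G\<close>, where \<open>G(X,Y)Z = g(Y,Z)X - g(X,Z)Y\<close>, and if \<open>\<alpha>\<^sup>2 \<noteq> 1\<close>,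
  constant curvature of \<open>\<nabla>\<^sup>\<alpha>\<close> would force constant curvature of \<open>g\<close>.
\<close>

section \<open>The algebra of smooth functions\<close>

text \<open>A derivative at a point of an open set depends only on the values in that set. This lets
  the sum and product rules, available only at the points of \<open>S\<close>, replace the formal
  derivative inside \<open>Ck_on\<close>.\<close>

lemma Ck_on_cong:
  assumes "open S" "\<And>x. x \<in> S \<Longrightarrow> f x = g x"
  shows "Ck_on k S f \<longleftrightarrow> Ck_on k S g"
  using assms(2)
proof (induction k arbitrary: f g)
  case 0
  then show ?case by (auto cong: continuous_on_cong)
next
  case (Suc k)
  have der: "(f has_derivative F) (at x) \<longleftrightarrow> (g has_derivative F) (at x)" if "x \<in> S" for x F
    using has_derivative_transform_within_open[OF _ assms(1) that, of f F UNIV g]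
      has_derivative_transform_within_open[OF _ assms(1) that, of g F UNIV f] Suc.prems
    by auto
  then have "f differentiable at x \<longleftrightarrow> g differentiable at x"
    and "frechet_derivative f (at x) = frechet_derivative g (at x)" if "x \<in> S" for x
    using that by (auto simp: differentiable_def frechet_derivative_def)
  then show ?case
    using Suc.IH[of "\<lambda>x. frechet_derivative f (at x) v" "\<lambda>x. frechet_derivative g (at x) v" for v]
    by auto
qed

text \<open>The product rule leaves undifferentiated factors; their known regularity has to be
  lowered by one order before an induction hypothesis applies to them.\<close>

lemma Ck_on_Suc_D: "Ck_on (Suc k) S f \<Longrightarrow> Ck_on k S f"
proof (induction k arbitrary: f)
  case 0
  then show ?case
    by (auto intro!: continuous_at_imp_continuous_on differentiable_imp_continuous_within)
next
  case (Suc k)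
  have "Ck_on k S (\<lambda>x. frechet_derivative f (at x) v)" for v
    using Suc.prems by (intro Suc.IH) simp
  then show ?case
    using Suc.prems by simp
qed

lemma Ck_on_const: "Ck_on k S (\<lambda>x. c)"
  by (induction k arbitrary: c) (simp_all add: frechet_derivative_const)

lemma Ck_on_add:
  assumes "open S" "Ck_on k S f" "Ck_on k S g"
  shows "Ck_on k S (\<lambda>x. f x + g x)"
  using assms(2,3)
proof (induction k arbitrary: f g)
  case 0
  then show ?case by (simp add: continuous_on_add)
next
  case (Suc k)
  have "Ck_on k S (\<lambda>x. frechet_derivative (\<lambda>x. f x + g x) (at x) v)" for v
  proof -
    \<comment> \<open>\<open>frechet_derivative\<close> is a choice term, meaningful only where the
      function is differentiable, so the identity is claimed on \<open>S\<close> alone and is used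
      through \<open>Ck_on_cong\<close>.\<close>
    have "frechet_derivative (\<lambda>x. f x + g x) (at x) v
        = frechet_derivative f (at x) v + frechet_derivative g (at x) v" if "x \<in> S" for x
    proof -
      have "((\<lambda>x. f x + g x) has_derivative
          (\<lambda>v. frechet_derivative f (at x) v + frechet_derivative g (at x) v)) (at x)"
        using Suc.prems that by (intro has_derivative_add) (simp_all flip: frechet_derivative_works)
      then show ?thesis
        by (simp flip: frechet_derivative_at)
    qed
    moreover have "Ck_on k S (\<lambda>x. frechet_derivative f (at x) v + frechet_derivative g (at x) v)"
      using Suc.prems by (intro Suc.IH) simp_all
    ultimately show ?thesis
      by (subst Ck_on_cong[OF assms(1)]) auto
  qed
  then show ?case using Suc.prems by simp
qed

lemma Ck_on_mult:
  fixes f g :: "'a::real_normed_vector \<Rightarrow> 'b::real_normed_algebra"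
  assumes "open S" "Ck_on k S f" "Ck_on k S g"
  shows "Ck_on k S (\<lambda>x. f x * g x)"
  using assms(2,3)
proof (induction k arbitrary: f g)
  case 0
  then show ?case by (simp add: continuous_on_mult)
next
  case (Suc k)
  have "Ck_on k S (\<lambda>x. frechet_derivative (\<lambda>x. f x * g x) (at x) v)" for v
  proof -
    have "frechet_derivative (\<lambda>x. f x * g x) (at x) v
        = f x * frechet_derivative g (at x) v + frechet_derivative f (at x) v * g x"
      if "x \<in> S" for x
    proof -
      have "((\<lambda>x. f x * g x) has_derivative
          (\<lambda>v. f x * frechet_derivative g (at x) v + frechet_derivative f (at x) v * g x)) (at x)"
        using Suc.prems that by (intro has_derivative_mult) (simp_all flip: frechet_derivative_works)
      then show ?thesis
        by (simp flip: frechet_derivative_at)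
    qed
    moreover have "Ck_on k S
        (\<lambda>x. f x * frechet_derivative g (at x) v + frechet_derivative f (at x) v * g x)"
      \<comment> \<open>Each summand is a product of one undifferentiated factor and one derivative,
        both of order \<open>k\<close>.\<close>
      using Suc.prems Ck_on_Suc_D[OF Suc.prems(1)] Ck_on_Suc_D[OF Suc.prems(2)]
      by (intro Ck_on_add[OF assms(1)] Suc.IH) simp_all
    ultimately show ?thesis
      by (subst Ck_on_cong[OF assms(1)]) auto
  qed
  then show ?case using Suc.prems by (simp add: differentiable_mult)
qed

lemma smooth_functions_const: "(\<lambda>p. c) \<in> smooth_functions A"
  by (simp add: smooth_functions_def smooth_on_def o_def Ck_on_const split: prod.splits)

lemma smooth_atlas_open: "smooth_atlas A \<Longrightarrow> (U, \<phi>) \<in> A \<Longrightarrow> open (\<phi> ` U)"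
  by (auto simp: smooth_atlas_def)

lemma smooth_functions_add:
  assumes "smooth_atlas A" "f \<in> smooth_functions A" "h \<in> smooth_functions A"
  shows "(\<lambda>p. f p + h p) \<in> smooth_functions A"
  using assms(2,3) smooth_atlas_open[OF assms(1)]
  by (auto simp: smooth_functions_def smooth_on_def o_def intro!: Ck_on_add)

lemma smooth_functions_mult:
  assumes "smooth_atlas A" "f \<in> smooth_functions A" "h \<in> smooth_functions A"
  shows "(\<lambda>p. f p * h p) \<in> smooth_functions A"
  using assms(2,3) smooth_atlas_open[OF assms(1)]
  by (auto simp: smooth_functions_def smooth_on_def o_def intro!: Ck_on_mult)

lemma smooth_functions_diff:
  assumes "smooth_atlas A" "f \<in> smooth_functions A" "h \<in> smooth_functions A"
  shows "(\<lambda>p. f p - h p) \<in> smooth_functions A"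
  using smooth_functions_add[OF assms(1,2)
      smooth_functions_mult[OF assms(1) smooth_functions_const[of "-1"] assms(3)]]
  by simp


section \<open>The module of vector fields\<close>

lemma vector_fieldsD:
  assumes "X \<in> vector_fields A"
  shows vector_fields_smooth: "f \<in> smooth_functions A \<Longrightarrow> X f \<in> smooth_functions A"
    and vector_fields_add: "f \<in> smooth_functions A \<Longrightarrow> h \<in> smooth_functions A \<Longrightarrow>
      X (\<lambda>p. f p + h p) = (\<lambda>p. X f p + X h p)"
    and vector_fields_cmult: "f \<in> smooth_functions A \<Longrightarrow> X (\<lambda>p. c * f p) = (\<lambda>p. c * X f p)"
    and vector_fields_mult: "f \<in> smooth_functions A \<Longrightarrow> h \<in> smooth_functions A \<Longrightarrow>
      X (\<lambda>p. f p * h p) = (\<lambda>p. f p * X h p + h p * X f p)"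
    and vector_fields_outside: "f \<notin> smooth_functions A \<Longrightarrow> X f = (\<lambda>p. 0)"
  using assms unfolding vector_fields_def by blast+

lemma vector_fields_diff:
  assumes "smooth_atlas A" "X \<in> vector_fields A" "f \<in> smooth_functions A" "h \<in> smooth_functions A"
  shows "X (\<lambda>p. f p - h p) = (\<lambda>p. X f p - X h p)"
  using vector_fields_add[OF assms(2,3)
      smooth_functions_mult[OF assms(1) smooth_functions_const[of "-1"] assms(4)]]
    vector_fields_cmult[OF assms(2,4), of "-1"]
  by simp

text \<open>The Leibniz rule for 1 = 1 * 1 gives X 1 = 2 X 1, hence X 1 = 0; homogeneity does the
  rest.\<close>

lemma vector_fields_const:
  assumes "X \<in> vector_fields A"
  shows "X (\<lambda>p. c) = (\<lambda>p. 0)"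
proof -
  have "X (\<lambda>p. 1 * 1) = (\<lambda>p. 1 * X (\<lambda>p. 1) p + 1 * X (\<lambda>p. 1) p)"
    by (rule vector_fields_mult[OF assms smooth_functions_const smooth_functions_const])
  then have "X (\<lambda>p. 1) p = 0" for p
    by (simp add: fun_eq_iff)
  then show ?thesis
    using vector_fields_cmult[OF assms smooth_functions_const[of 1], of c] by simp
qed

lemma vf_add_vector_fields:
  assumes "smooth_atlas A" "X \<in> vector_fields A" "Y \<in> vector_fields A"
  shows "vf_add X Y \<in> vector_fields A"
  unfolding vector_fields_def vf_add_def mem_Collect_eq
  using vector_fieldsD[OF assms(2)] vector_fieldsD[OF assms(3)]
  by (intro conjI ballI allI impI)
    (simp_all add: smooth_functions_add[OF assms(1)] algebra_simps)

lemma vf_scale_vector_fields: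
  assumes "smooth_atlas A" "h \<in> smooth_functions A" "X \<in> vector_fields A"
  shows "vf_scale h X \<in> vector_fields A"
  unfolding vector_fields_def vf_scale_def mem_Collect_eq
  using vector_fieldsD[OF assms(3)]
  by (intro conjI ballI allI impI)
    (simp_all add: smooth_functions_mult[OF assms(1)] assms(2) algebra_simps)

text \<open>The axioms for metrics mention only sums and scalings; this form reduces the laws for
  differences to them.\<close>

lemma vf_diff_eq: "vf_diff X Y = vf_add X (vf_scale (\<lambda>p. -1) Y)"
  by (simp add: vf_diff_def vf_add_def vf_scale_def)

lemma vf_diff_vector_fields:
  assumes "smooth_atlas A" "X \<in> vector_fields A" "Y \<in> vector_fields A"
  shows "vf_diff X Y \<in> vector_fields A"
  by (simp add: vf_diff_eq vf_add_vector_fields vf_scale_vector_fields smooth_functions_const assms)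

text \<open>In the Leibniz rule for the commutator, the products of first derivatives are symmetric
  in \<open>X\<close> and \<open>Y\<close> and cancel.\<close>

lemma lie_bracket_vector_fields:
  assumes "smooth_atlas A" "X \<in> vector_fields A" "Y \<in> vector_fields A"
  shows "lie_bracket X Y \<in> vector_fields A"
  unfolding vector_fields_def lie_bracket_def mem_Collect_eq
  using vector_fieldsD[OF assms(2)] vector_fieldsD[OF assms(3)]
  by (intro conjI ballI allI impI)
    (simp_all add: smooth_functions_diff[OF assms(1)] smooth_functions_mult[OF assms(1)]
      vector_fields_const[OF assms(2)] vector_fields_const[OF assms(3)] algebra_simps)


section \<open>Metrics\<close>

lemma pseudo_riemannian_metricD:
  assumes "pseudo_riemannian_metric A g" "X \<in> vector_fields A" "Y \<in> vector_fields A"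
  shows metric_smooth: "g X Y \<in> smooth_functions A"
    and metric_commute: "g X Y = g Y X"
    and metric_add_left: "Z \<in> vector_fields A \<Longrightarrow> g (vf_add X Y) Z = (\<lambda>p. g X Z p + g Y Z p)"
    and metric_scale_left: "h \<in> smooth_functions A \<Longrightarrow> g (vf_scale h X) Y = (\<lambda>p. h p * g X Y p)"
  using assms unfolding pseudo_riemannian_metric_def by blast+

lemma metric_diff_left:
  assumes "smooth_atlas A" "pseudo_riemannian_metric A g"
    and "X \<in> vector_fields A" "Y \<in> vector_fields A" "Z \<in> vector_fields A"
  shows "g (vf_diff X Y) Z = (\<lambda>p. g X Z p - g Y Z p)"
  using assms
  by (simp add: vf_diff_eq metric_add_left[OF assms(2)] metric_scale_left[OF assms(2)]
      vf_scale_vector_fields smooth_functions_const)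

lemma metric_right:
  assumes "smooth_atlas A" "pseudo_riemannian_metric A g"
    and "X \<in> vector_fields A" "Y \<in> vector_fields A" "Z \<in> vector_fields A"
  shows metric_add_right: "g Z (vf_add X Y) = (\<lambda>p. g Z X p + g Z Y p)"
    and metric_diff_right: "g Z (vf_diff X Y) = (\<lambda>p. g Z X p - g Z Y p)"
  using assms metric_commute[OF assms(2), of Z]
  by (simp_all add: metric_add_left[OF assms(2)] metric_diff_left[OF assms(1,2)]
      vf_add_vector_fields vf_diff_vector_fields)

lemma metric_scale_right:
  assumes "smooth_atlas A" "pseudo_riemannian_metric A g"
    and "h \<in> smooth_functions A" "X \<in> vector_fields A" "Z \<in> vector_fields A"
  shows "g Z (vf_scale h X) = (\<lambda>p. h p * g Z X p)"
  using assms metric_commute[OF assms(2), of Z]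
  by (simp add: metric_scale_left[OF assms(2)] vf_scale_vector_fields)

text \<open>Nondegeneracy makes the difference of the fields vanish on every smooth function; on all
  other functions both fields are 0 by convention. Together this is equality in HOL.\<close>

lemma metric_eqI:
  assumes "smooth_atlas A" "pseudo_riemannian_metric A g"
    and "X \<in> vector_fields A" "Y \<in> vector_fields A"
    and eq: "\<And>Z. Z \<in> vector_fields A \<Longrightarrow> g Z X = g Z Y"
  shows "X = Y"
proof (intro ext)
  fix f p
  have D: "vf_diff X Y \<in> vector_fields A"
    using assms by (simp add: vf_diff_vector_fields)
  have "g (vf_diff X Y) Z p = 0" if "Z \<in> vector_fields A" for Z
    using that eq[OF that] assms metric_commute[OF assms(2) _ that]
    by (simp add: metric_diff_left[OF assms(1,2)])
  then have "\<forall>f\<in>smooth_functions A. vf_diff X Y f p = 0"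
    using assms(2) D unfolding pseudo_riemannian_metric_def by blast
  then show "X f p = Y f p"
    using vector_fields_outside[OF assms(3)] vector_fields_outside[OF assms(4)]
    by (cases "f \<in> smooth_functions A") (auto simp: vf_diff_def)
qed


section \<open>Affine connections\<close>

lemma affine_connectionD:
  assumes "affine_connection A D" "X \<in> vector_fields A" "Y \<in> vector_fields A"
  shows connection_vector_fields: "D X Y \<in> vector_fields A"
    and connection_add_left:
      "Z \<in> vector_fields A \<Longrightarrow> D (vf_add X Y) Z = vf_add (D X Z) (D Y Z)"
    and connection_scale_left: "h \<in> smooth_functions A \<Longrightarrow> D (vf_scale h X) Y = vf_scale h (D X Y)"
    and connection_add_right:
      "Z \<in> vector_fields A \<Longrightarrow> D X (vf_add Y Z) = vf_add (D X Y) (D X Z)"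
    and connection_scale_right: "h \<in> smooth_functions A \<Longrightarrow>
      D X (vf_scale h Y) = vf_add (vf_scale (X h) Y) (vf_scale h (D X Y))"
  using assms unfolding affine_connection_def by blast+

text \<open>The derivative of a constant vanishes, so a connection is real-linear in its second
  argument.\<close>

lemma connection_cscale_right:
  assumes "affine_connection A D" "X \<in> vector_fields A" "Y \<in> vector_fields A"
  shows "D X (vf_scale (\<lambda>p. c) Y) = vf_scale (\<lambda>p. c) (D X Y)"
  using connection_scale_right[OF assms smooth_functions_const, of c]
    vector_fields_const[OF assms(2), of c]
  by (simp add: vf_add_def vf_scale_def)

lemma curvature_vector_fields:
  assumes "smooth_atlas A" "affine_connection A D"
    and "X \<in> vector_fields A" "Y \<in> vector_fields A" "Z \<in> vector_fields A"
  shows "curvature D X Y Z \<in> vector_fields A"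
  unfolding curvature_def using assms
  by (intro vf_diff_vector_fields connection_vector_fields[OF assms(2)] lie_bracket_vector_fields)

section \<open>Duality of connections and its effect on curvature\<close>

lemma affine_connection_cong:
  assumes "smooth_atlas A" "connection_eq A D E" "affine_connection A D"
  shows "affine_connection A E"
proof -
  have "E X Y = D X Y" if "X \<in> vector_fields A" "Y \<in> vector_fields A" for X Y
    using assms(2) that by (simp add: connection_eq_def)
  then show ?thesis
    using assms(3)
    by (simp add: affine_connection_def vf_add_vector_fields[OF assms(1)]
        vf_scale_vector_fields[OF assms(1)])
qed

text \<open>Off the vector fields a connection takes arbitrary values, so a dual connection can be
  characterised only up to \<open>connection_eq\<close>.\<close>

lemma dual_connection_cong:
  assumes "smooth_atlas A" "connection_eq A E E'" "dual_connection A g D E"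
  shows "dual_connection A g D E'"
proof -
  have "E' X Y = E X Y" if "X \<in> vector_fields A" "Y \<in> vector_fields A" for X Y
    using assms(2) that by (simp add: connection_eq_def)
  then show ?thesis
    using assms(3) affine_connection_cong[OF assms(1,2)]
    by (simp add: dual_connection_def torsion_free_def)
qed

text \<open>The duality identity prescribes \<open>g Z (E X Y)\<close> for every \<open>Z\<close>,
  and \<open>g\<close> is nondegenerate.\<close>

lemma dual_connection_unique:
  assumes "smooth_atlas A" "pseudo_riemannian_metric A g"
    and "dual_connection A g D E" "dual_connection A g D E'"
  shows "connection_eq A E E'"
  unfolding connection_eq_def
proof (intro ballI)
  fix X Y assume X: "X \<in> vector_fields A" and Y: "Y \<in> vector_fields A"
  have aff: "affine_connection A E" "affine_connection A E'"
    using assms(3,4) by (simp_all add: dual_connection_def)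
  have "g Z (E X Y) = g Z (E' X Y)" if Z: "Z \<in> vector_fields A" for Z
  proof -
    have "X (g Z Y) = (\<lambda>p. g (D X Z) Y p + g Z (E X Y) p)"
      "X (g Z Y) = (\<lambda>p. g (D X Z) Y p + g Z (E' X Y) p)"
      using assms(3,4) X Y Z unfolding dual_connection_def by blast+
    then show ?thesis
      by (auto simp: fun_eq_iff)
  qed
  then show "E X Y = E' X Y"
    using X Y by (intro metric_eqI[OF assms(1,2)] connection_vector_fields[OF aff(1)]
        connection_vector_fields[OF aff(2)])
qed

text \<open>Duality moves the derivatives one by one from \<open>Z\<close> to \<open>W\<close>. The
  order of differentiation is reversed, which produces the sign.\<close>

lemma dual_curvature:
  assumes "smooth_atlas A" "pseudo_riemannian_metric A g"
    and D: "affine_connection A D" and "dual_connection A g D E"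
    and X: "X \<in> vector_fields A" and Y: "Y \<in> vector_fields A"
    and Z: "Z \<in> vector_fields A" and W: "W \<in> vector_fields A"
  shows "g (curvature D X Y Z) W = (\<lambda>p. - g Z (curvature E X Y W) p)"
proof
  fix p
  have E: "affine_connection A E"
    and dual: "\<And>X Y Z. \<lbrakk>X \<in> vector_fields A; Y \<in> vector_fields A; Z \<in> vector_fields A\<rbrakk>
      \<Longrightarrow> g (D X Y) Z = (\<lambda>p. X (g Y Z) p - g Y (E X Z) p)"
    using assms(4) by (auto simp: dual_connection_def)
  note vf = connection_vector_fields[OF D] connection_vector_fields[OF E] X Y Z W
    vf_diff_vector_fields[OF assms(1)] lie_bracket_vector_fields[OF assms(1)]
  note sm = metric_smooth[OF assms(2)] vector_fields_smooth
  \<comment> \<open>The two middle terms together are symmetric in \<open>X\<close> and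
    \<open>Y\<close>, so they drop out of the commutator.\<close>
  have second: "g (D X (D Y Z)) W p
      = X (Y (g Z W)) p - X (g Z (E Y W)) p - Y (g Z (E X W)) p + g Z (E Y (E X W)) p"
    if "X \<in> vector_fields A" "Y \<in> vector_fields A" for X Y
    using that by (simp add: dual vf sm vector_fields_diff[OF assms(1)])
  have "g (D (lie_bracket X Y) Z) W p
      = X (Y (g Z W)) p - Y (X (g Z W)) p - g Z (E (lie_bracket X Y) W) p"
    \<comment> \<open>The bracket stays folded while duality is applied to it as a vector field;
      unfolded afterwards, it acts on \<open>g Z W\<close> and cancels the remaining second
      derivatives of this function.\<close>
    by (simp add: dual vf) (simp add: lie_bracket_def)
  then show "g (curvature D X Y Z) W p = - g Z (curvature E X Y W) p"
    using second[OF X Y] second[OF Y X]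
    by (simp add: curvature_def metric_diff_left[OF assms(1,2)] metric_diff_right[OF assms(1,2)] vf)
qed

text \<open>The endomorphism taking \<open>Z\<close> to g(Y,Z)X - g(X,Z)Y is skew-adjoint for
  \<open>g\<close>, so the sign in \<open>dual_curvature\<close> is absorbed and the constant
  \<open>k\<close> survives.\<close>

lemma dual_curvature_constant:
  assumes "smooth_atlas A" "pseudo_riemannian_metric A g"
    and D: "affine_connection A D" and "dual_connection A g D E"
    and R: "\<And>X Y Z. \<lbrakk>X \<in> vector_fields A; Y \<in> vector_fields A; Z \<in> vector_fields A\<rbrakk> \<Longrightarrow>
      curvature D X Y Z =
        vf_scale (\<lambda>p. k) (vf_diff (vf_scale (g Y Z) X) (vf_scale (g X Z) Y))"
    and X: "X \<in> vector_fields A" and Y: "Y \<in> vector_fields A" and Z: "Z \<in> vector_fields A"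
  shows "curvature E X Y Z =
    vf_scale (\<lambda>p. k) (vf_diff (vf_scale (g Y Z) X) (vf_scale (g X Z) Y))"
proof (rule metric_eqI[OF assms(1,2)])
  have E: "affine_connection A E"
    using assms(4) by (simp add: dual_connection_def)
  note vf = X Y Z vf_diff_vector_fields[OF assms(1)] vf_scale_vector_fields[OF assms(1)]
    smooth_functions_const metric_smooth[OF assms(2)]
  show "curvature E X Y Z \<in> vector_fields A"
    by (rule curvature_vector_fields[OF assms(1) E X Y Z])
  show "vf_scale (\<lambda>p. k) (vf_diff (vf_scale (g Y Z) X) (vf_scale (g X Z) Y)) \<in> vector_fields A"
    by (simp add: vf)
  fix W assume W: "W \<in> vector_fields A"
  have "g W (curvature E X Y Z) = (\<lambda>p. - g (curvature D X Y W) Z p)"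
    \<comment> \<open>\<open>W\<close> and \<open>Z\<close> are interchanged here, so that the
      curvature of \<open>E\<close> acts on \<open>Z\<close>.\<close>
    using dual_curvature[OF assms(1,2) D assms(4) X Y W Z] by (simp add: fun_eq_iff)
  also have "\<dots> = g W (vf_scale (\<lambda>p. k) (vf_diff (vf_scale (g Y Z) X) (vf_scale (g X Z) Y)))"
    using metric_commute[OF assms(2) W X] metric_commute[OF assms(2) W Y]
    by (simp add: R W vf metric_scale_left[OF assms(2)] metric_diff_left[OF assms(1,2)]
        metric_scale_right[OF assms(1,2)] metric_diff_right[OF assms(1,2)] fun_eq_iff algebra_simps)
  finally show "g W (curvature E X Y Z) = \<dots>" .
qed


section \<open>The \<open>\<alpha>\<close>-connections\<close>

lemma alpha_connection_apply:
  "alpha_connection L D \<alpha> X Y f p = (1 - \<alpha>) * L X Y f p + \<alpha> * D X Y f p"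
  by (simp add: alpha_connection_def difference_tensor_def vf_add_def vf_scale_def vf_diff_def
      algebra_simps)

text \<open>The weights 1 - \<alpha> and \<alpha> add up to 1, so the derivative terms
  \<open>vf_scale (X h) Y\<close> of the two connections combine to exactly one.\<close>

lemma affine_connection_alpha:
  assumes "smooth_atlas A" "affine_connection A L" "affine_connection A D"
  shows "affine_connection A (alpha_connection L D \<alpha>)"
  unfolding affine_connection_def
proof (intro conjI ballI)
  fix X Y assume "X \<in> vector_fields A" "Y \<in> vector_fields A"
  then show "alpha_connection L D \<alpha> X Y \<in> vector_fields A"
    unfolding alpha_connection_def difference_tensor_def
    using assms by (intro vf_add_vector_fields vf_scale_vector_fields vf_diff_vector_fields
        smooth_functions_const connection_vector_fields[OF assms(2)]
        connection_vector_fields[OF assms(3)])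
next
  fix X Y Z assume [simp]: "X \<in> vector_fields A" "Y \<in> vector_fields A" "Z \<in> vector_fields A"
  show "alpha_connection L D \<alpha> (vf_add X Y) Z =
    vf_add (alpha_connection L D \<alpha> X Z) (alpha_connection L D \<alpha> Y Z)"
    by (intro ext, simp add: alpha_connection_apply connection_add_left[OF assms(2)]
        connection_add_left[OF assms(3)])
      (simp add: vf_add_def alpha_connection_apply algebra_simps)
  show "alpha_connection L D \<alpha> X (vf_add Y Z) =
    vf_add (alpha_connection L D \<alpha> X Y) (alpha_connection L D \<alpha> X Z)"
    by (intro ext, simp add: alpha_connection_apply connection_add_right[OF assms(2)]
        connection_add_right[OF assms(3)])
      (simp add: vf_add_def alpha_connection_apply algebra_simps)
next
  fix h X Y assume [simp]: "h \<in> smooth_functions A" "X \<in> vector_fields A" "Y \<in> vector_fields A"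
  show "alpha_connection L D \<alpha> (vf_scale h X) Y =
    vf_scale h (alpha_connection L D \<alpha> X Y)"
    by (intro ext, simp add: alpha_connection_apply connection_scale_left[OF assms(2)]
        connection_scale_left[OF assms(3)])
      (simp add: vf_scale_def alpha_connection_apply algebra_simps)
  show "alpha_connection L D \<alpha> X (vf_scale h Y) =
    vf_add (vf_scale (X h) Y) (vf_scale h (alpha_connection L D \<alpha> X Y))"
    by (intro ext, simp add: alpha_connection_apply connection_scale_right[OF assms(2)]
        connection_scale_right[OF assms(3)])
      (simp add: vf_add_def vf_scale_def alpha_connection_apply algebra_simps)
qed

text \<open>Again by the sum of the weights: the bracket is reproduced with coefficient 1.\<close>

lemma torsion_free_alpha:
  assumes "torsion_free A L" "torsion_free A D"
  shows "torsion_free A (alpha_connection L D \<alpha>)"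
  unfolding torsion_free_def
proof (intro ballI ext)
  fix X Y f p assume "X \<in> vector_fields A" "Y \<in> vector_fields A"
  then have "vf_diff (L X Y) (L Y X) f p = lie_bracket X Y f p"
    "vf_diff (D X Y) (D Y X) f p = lie_bracket X Y f p"
    using assms by (simp_all add: torsion_free_def)
  then have "L X Y f p = lie_bracket X Y f p + L Y X f p"
    "D X Y f p = lie_bracket X Y f p + D Y X f p"
    by (simp_all add: vf_diff_def)
  then show "vf_diff (alpha_connection L D \<alpha> X Y) (alpha_connection L D \<alpha> Y X) f p
      = lie_bracket X Y f p"
    by (simp add: vf_diff_def alpha_connection_apply algebra_simps)
qed

text \<open>Second covariant derivatives are quadratic in \<alpha> and the bracket term is affine.
  The coefficients are the Lagrange polynomials for the nodes 0, 1, -1, where 0 gives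
  \<open>L\<close> and 1 gives \<open>D\<close>.\<close>

lemma curvature_alpha:
  assumes "smooth_atlas A" "affine_connection A L" "affine_connection A D"
    and X: "X \<in> vector_fields A" and Y: "Y \<in> vector_fields A" and Z: "Z \<in> vector_fields A"
  shows "curvature (alpha_connection L D \<alpha>) X Y Z f p =
    (1 - \<alpha>\<^sup>2) * curvature L X Y Z f p +
    (\<alpha>\<^sup>2 + \<alpha>) / 2 * curvature D X Y Z f p +
    (\<alpha>\<^sup>2 - \<alpha>) / 2 * curvature (alpha_connection L D (-1)) X Y Z f p"
proof -
  \<comment> \<open>General in the parameter, because it serves both for the given \<alpha> and for
    -1.\<close>
  have second: "alpha_connection L D \<alpha> X (alpha_connection L D \<alpha> Y Z) f p =
      (1 - \<alpha>) * ((1 - \<alpha>) * L X (L Y Z) f p + \<alpha> * L X (D Y Z) f p) +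
      \<alpha> * ((1 - \<alpha>) * D X (L Y Z) f p + \<alpha> * D X (D Y Z) f p)"
    if X: "X \<in> vector_fields A" and Y: "Y \<in> vector_fields A" for X Y \<alpha>
  proof -
    have eq: "alpha_connection L D \<alpha> Y Z
        = vf_add (vf_scale (\<lambda>p. 1 - \<alpha>) (L Y Z)) (vf_scale (\<lambda>p. \<alpha>) (D Y Z))"
      by (simp add: fun_eq_iff alpha_connection_apply vf_add_def vf_scale_def)
    note vf = X Y Z connection_vector_fields[OF assms(2)] connection_vector_fields[OF assms(3)]
      vf_scale_vector_fields[OF assms(1) smooth_functions_const]
    show ?thesis
      \<comment> \<open>Only the outer connection is evaluated; the inner one becomes a combination
        of vector fields, to which real-linearity applies.\<close>
      unfolding alpha_connection_apply[of L D \<alpha> X] unfolding eq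
      by (simp add: vf connection_add_right[OF assms(2)] connection_add_right[OF assms(3)]
          connection_cscale_right[OF assms(2)] connection_cscale_right[OF assms(3)])
        (simp add: vf_add_def vf_scale_def)
  qed
  show ?thesis
    unfolding curvature_def vf_diff_def second[OF X Y] second[OF Y X]
    by (simp add: alpha_connection_apply field_simps power2_eq_square)
qed

text \<open>The tensor \<open>g(K(X,Y), Z)\<close> is symmetric in \<open>X, Y\<close> because both connections are torsion-free, and
  its symmetrisation in \<open>Y, Z\<close> is minus the cubic form. Exchanging two arguments of the cubic form
  then shows that it is totally symmetric.\<close>

lemma dual_connection_alpha:
  assumes "smooth_atlas A" "statistical_structure A g D" "levi_civita A g L"
  shows "dual_connection A g D (alpha_connection L D (-1))"
proof -
  have g: "pseudo_riemannian_metric A g" and D: "affine_connection A D" "torsion_free A D"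
    and L: "affine_connection A L" "torsion_free A L"
    using assms by (auto simp: statistical_structure_def levi_civita_def)
  define K where "K = difference_tensor L D"
  have K: "K X Y \<in> vector_fields A" if "X \<in> vector_fields A" "Y \<in> vector_fields A" for X Y
    using that by (simp add: K_def difference_tensor_def vf_diff_vector_fields[OF assms(1)]
        connection_vector_fields[OF D(1)] connection_vector_fields[OF L(1)])
  have K_commute: "K X Y = K Y X" if "X \<in> vector_fields A" "Y \<in> vector_fields A" for X Y
  proof (intro ext)
    fix f p
    have "vf_diff (L X Y) (L Y X) f p = vf_diff (D X Y) (D Y X) f p"
      using that L(2) D(2) by (simp add: torsion_free_def)
    then show "K X Y f p = K Y X f p"
      by (simp add: K_def difference_tensor_def vf_diff_def)
  qed
  have split: "D X Y = vf_add (L X Y) (K X Y)" for X Y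
    by (simp add: K_def difference_tensor_def vf_add_def vf_diff_def)
  have LC: "X (g Y Z) = (\<lambda>p. g (L X Y) Z p + g Y (L X Z) p)"
    if "X \<in> vector_fields A" "Y \<in> vector_fields A" "Z \<in> vector_fields A" for X Y Z
  proof
    fix p
    have "cubic_form g L X Y Z p = 0"
      using assms(3) that by (simp add: levi_civita_def)
    then show "X (g Y Z) p = g (L X Y) Z p + g Y (L X Z) p"
      by (simp add: cubic_form_def)
  qed
  have cubic: "cubic_form g D X Y Z = (\<lambda>p. - g (K X Y) Z p - g (K X Z) Y p)"
    if "X \<in> vector_fields A" "Y \<in> vector_fields A" "Z \<in> vector_fields A" for X Y Z
    using that
    by (simp add: cubic_form_def LC[OF that] split metric_add_left[OF g] metric_add_right[OF assms(1) g] K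
        connection_vector_fields[OF L(1)] metric_commute[OF g, of Y "K X Z"])
  have K_sym: "g (K X Y) Z = g (K X Z) Y"
    if X: "X \<in> vector_fields A" and Y: "Y \<in> vector_fields A" and Z: "Z \<in> vector_fields A" for X Y Z
  proof -
    \<comment> \<open>Both sides contain g(K(Y,Z),X); once it cancels, the claim is left.\<close>
    have "cubic_form g D Y X Z = cubic_form g D Z X Y"
      using assms(2) X Y Z unfolding statistical_structure_def by metis
    then show ?thesis
      using cubic[OF Y X Z] cubic[OF Z X Y] X Y Z
      by (simp add: fun_eq_iff K_commute[of Y X] K_commute[of Z X] K_commute[of Z Y])
  qed
  have alpha: "alpha_connection L D (-1) X Y = vf_diff (L X Y) (K X Y)" for X Y
    by (simp add: fun_eq_iff K_def difference_tensor_def alpha_connection_apply vf_diff_def)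
  show ?thesis
    unfolding dual_connection_def
  proof (intro conjI ballI)
    show "affine_connection A (alpha_connection L D (-1))"
      by (rule affine_connection_alpha[OF assms(1) L(1) D(1)])
    show "torsion_free A (alpha_connection L D (-1))"
      by (rule torsion_free_alpha[OF L(2) D(2)])
    fix X Y Z
    assume XYZ: "X \<in> vector_fields A" "Y \<in> vector_fields A" "Z \<in> vector_fields A"
    then show "X (g Y Z) = (\<lambda>p. g (D X Y) Z p + g Y (alpha_connection L D (-1) X Z) p)"
      \<comment> \<open>\<open>K\<close> enters with opposite signs in the two summands, and
        \<open>K_sym\<close> cancels its contributions.\<close>
      by (simp add: LC[OF XYZ] alpha split metric_add_left[OF g] metric_diff_right[OF assms(1) g] K
          connection_vector_fields[OF L(1)] metric_commute[OF g, of Y "K X Z"] K_sym[of X Y Z])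
  qed
qed

section \<open>Which \<alpha>-connections have constant curvature\<close>

theorem proposition2p8:
  fixes A :: "('m::{t2_space, second_countable_topology}, 'n::finite) chart set"
    and g :: "'m metric"
    and D L :: "'m connection"
  assumes "smooth_atlas A"
    and "orientable A"
    and "statistical_structure A g D"
    and "levi_civita A g L"
    and "constant_curvature A g D"
    and "\<not> constant_curvature A g L"
  shows "(\<forall>\<alpha>::real. constant_curvature A g (alpha_connection L D \<alpha>) \<longleftrightarrow> \<alpha> = 1 \<or> \<alpha> = -1) \<and>
         connection_eq A (alpha_connection L D 1) D \<and>
         (\<forall>D'. dual_connection A g D D' \<longleftrightarrow> connection_eq A (alpha_connection L D (-1)) D')"
proof (intro conjI allI)
  have g: "pseudo_riemannian_metric A g" and D: "affine_connection A D"
    and L: "affine_connection A L"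
    using assms by (auto simp: statistical_structure_def levi_civita_def)
  note dual = dual_connection_alpha[OF assms(1,3,4)]
  define G where "G X Y Z = vf_diff (vf_scale (g Y Z) X) (vf_scale (g X Z) Y)" for X Y Z
  obtain k where k: "\<And>X Y Z. \<lbrakk>X \<in> vector_fields A; Y \<in> vector_fields A; Z \<in> vector_fields A\<rbrakk> \<Longrightarrow>
      curvature D X Y Z = vf_scale (\<lambda>p. k) (G X Y Z)"
    using assms(5) unfolding constant_curvature_def G_def by blast
  have k': "curvature (alpha_connection L D (-1)) X Y Z = vf_scale (\<lambda>p. k) (G X Y Z)"
    if "X \<in> vector_fields A" "Y \<in> vector_fields A" "Z \<in> vector_fields A" for X Y Z
    using dual_curvature_constant[OF assms(1) g D dual k[unfolded G_def] that]
    by (simp add: G_def)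
  \<comment> \<open>Since \<open>k\<close> is common to the nodes 1 and -1, the terms linear in
    \<alpha> cancel.\<close>
  have R: "curvature (alpha_connection L D \<alpha>) X Y Z f p
      = (1 - \<alpha>\<^sup>2) * curvature L X Y Z f p + \<alpha>\<^sup>2 * k * G X Y Z f p"
    if "X \<in> vector_fields A" "Y \<in> vector_fields A" "Z \<in> vector_fields A" for X Y Z f p \<alpha>
    using curvature_alpha[OF assms(1) L D that, of \<alpha> f p] k[OF that] k'[OF that]
    by (simp add: vf_scale_def field_simps)
  show "constant_curvature A g (alpha_connection L D \<alpha>) \<longleftrightarrow> \<alpha> = 1 \<or> \<alpha> = -1" for \<alpha>
  proof
    assume "\<alpha> = 1 \<or> \<alpha> = -1"
    then have "\<alpha>\<^sup>2 = 1"
      by auto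
    then have "curvature (alpha_connection L D \<alpha>) X Y Z = vf_scale (\<lambda>p. k) (G X Y Z)"
      if "X \<in> vector_fields A" "Y \<in> vector_fields A" "Z \<in> vector_fields A" for X Y Z
      using R[OF that, of \<alpha>] by (simp add: fun_eq_iff vf_scale_def)
    then show "constant_curvature A g (alpha_connection L D \<alpha>)"
      unfolding constant_curvature_def G_def by blast
  next
    assume "constant_curvature A g (alpha_connection L D \<alpha>)"
    then obtain l where l: "\<And>X Y Z. \<lbrakk>X \<in> vector_fields A; Y \<in> vector_fields A; Z \<in> vector_fields A\<rbrakk> \<Longrightarrow>
        curvature (alpha_connection L D \<alpha>) X Y Z = vf_scale (\<lambda>p. l) (G X Y Z)"
      unfolding constant_curvature_def G_def by blast
    have "\<alpha>\<^sup>2 = 1"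
    proof (rule ccontr)
      assume ne: "\<alpha>\<^sup>2 \<noteq> 1"
      \<comment> \<open>The constant comes from equating \<open>R\<close> with \<open>l\<close>
        times \<open>G\<close> and solving for the curvature of \<open>L\<close>.\<close>
      have "curvature L X Y Z = vf_scale (\<lambda>p. (l - \<alpha>\<^sup>2 * k) / (1 - \<alpha>\<^sup>2)) (G X Y Z)"
        if "X \<in> vector_fields A" "Y \<in> vector_fields A" "Z \<in> vector_fields A" for X Y Z
      proof (intro ext)
        fix f p
        have "(1 - \<alpha>\<^sup>2) * curvature L X Y Z f p = (l - \<alpha>\<^sup>2 * k) * G X Y Z f p"
          using R[OF that, of \<alpha> f p] l[OF that] by (simp add: vf_scale_def algebra_simps)
        then show "curvature L X Y Z f p
            = vf_scale (\<lambda>p. (l - \<alpha>\<^sup>2 * k) / (1 - \<alpha>\<^sup>2)) (G X Y Z) f p"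
          using ne by (simp add: vf_scale_def eq_divide_eq mult.commute)
      qed
      then have "constant_curvature A g L"
        unfolding constant_curvature_def G_def by blast
      with assms(6) show False
        by simp
    qed
    then show "\<alpha> = 1 \<or> \<alpha> = -1"
      by (simp add: power2_eq_1_iff)
  qed
  show "connection_eq A (alpha_connection L D 1) D"
    by (simp add: connection_eq_def fun_eq_iff alpha_connection_apply)
  show "dual_connection A g D D' \<longleftrightarrow> connection_eq A (alpha_connection L D (-1)) D'" for D'
    \<comment> \<open>Uniqueness gives the forward direction, congruence the converse.\<close>
    using dual_connection_cong[OF assms(1) _ dual] dual_connection_unique[OF assms(1) g dual]
    by blast
qed

end
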